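(* Let $a,b>0$, and let $c=c_1+\mathrm{i}c_2=\sqrt{A}$ ($c_1,c_2\in\mathbb{R}$, $c_1\ge0$) with $A=1-b^2-4a-2\mathrm{i}b$. There exists some $C>0$ such that, if $t\geq 0$ satisfies $$E(t):=\mathrm{e}^{-2c_1t}+\langle a\rangle^2b^{-4}\mathrm{e}^{-c_1t}\le\frac1C,$$ then $$\left|\left(\frac{c_1^2+c_2^2}{c_2^2+1}\right)^{1/2}\mathrm{e}^{\frac{t(1-c_1)}{2}}\,\|\mathrm{e}^{-tM_{a,b}}\|-1\right|\le C\,E(t).$$
   Context: $$M_{a,b}=\begin{pmatrix}1&b&\sqrt a&0\\-b&1&0&\sqrt a\\-\sqrt a&0&0&0\\0&-\sqrt a&0&0\end{pmatrix}.$$ $\|\cdot\|$ is the operator norm on $4\times4$ matrices induced by the Euclidean norm on $\mathbb{C}^4$; $\langle a\rangle=(1+a^2)^{1/2}$. *)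

theory Defs
  imports "HOL-Analysis.Analysis"
begin

text \<open>The multiplication that the library places on the type of vectors is componentwise, so neither
  \<open>(^)\<close> nor \<open>exp\<close> is the matrix operation; both are defined here from \<open>(**)\<close>.\<close>

primrec matpow :: "complex^'n^'n \<Rightarrow> nat \<Rightarrow> complex^'n^'n" where
  "matpow A 0 = mat 1"
| "matpow A (Suc k) = A ** matpow A k"

definition matexp :: "complex^'n^'n \<Rightarrow> complex^'n^'n" where
  "matexp A = (\<Sum>k. (1 / fact k) *\<^sub>R matpow A k)"

text \<open>The norm on \<open>complex^'n\<close> is the Euclidean (Hermitian) one, so \<open>onorm\<close> of the induced map is the
  operator norm; the norm of the type \<open>complex^'n^'n\<close> itself would be the Frobenius norm.\<close>

definition opnorm :: "complex^'n^'n \<Rightarrow> real" where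
  "opnorm A = onorm (\<lambda>v. A *v v)"

definition M :: "real \<Rightarrow> real \<Rightarrow> complex^4^4" where
  "M a b = vector
    [vector [1, of_real b, of_real (sqrt a), 0],
     vector [- of_real b, 1, 0, of_real (sqrt a)],
     vector [- of_real (sqrt a), 0, 0, 0],
     vector [0, - of_real (sqrt a), 0, 0]]"

definition bracket :: "real \<Rightarrow> real" where
  "bracket a = sqrt (1 + a\<^sup>2)"

definition A_coeff :: "real \<Rightarrow> real \<Rightarrow> complex" where
  "A_coeff a b = of_real (1 - b\<^sup>2 - 4 * a) - 2 * \<i> * of_real b"

definition E :: "real \<Rightarrow> real \<Rightarrow> real \<Rightarrow> real \<Rightarrow> real" where
  "E a b c1 t = exp (- 2 * c1 * t) + (bracket a)\<^sup>2 / b ^ 4 * exp (- c1 * t)"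

lemma vector_4:
  "(vector [w, x, y, z] :: ('a::zero)^4) $ 1 = w"
  "(vector [w, x, y, z] :: ('a::zero)^4) $ 2 = x"
  "(vector [w, x, y, z] :: ('a::zero)^4) $ 3 = y"
  "(vector [w, x, y, z] :: ('a::zero)^4) $ 4 = z"
  by (simp_all add: vector_def)

lemma norm_matpow_vec: "norm (matpow A k *v x) \<le> opnorm A ^ k * norm x"
proof (induction k)
  case (Suc k)
  have "norm (A *v (matpow A k *v x)) \<le> opnorm A * norm (matpow A k *v x)"
    unfolding opnorm_def by (rule onorm) simp
  also have "\<dots> \<le> opnorm A * (opnorm A ^ k * norm x)"
    by (intro mult_left_mono Suc) (simp add: opnorm_def onorm_pos_le)
  finally show ?case by (simp add: matrix_vector_mul_assoc mult.assoc)
qed simp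

lemma norm_matpow_le:
  fixes A :: "complex^'n^'n"
  shows "norm (matpow A k) \<le> real (CARD('n) * CARD('n)) * opnorm A ^ k"
proof -
  have entry: "norm (matpow A k $ i $ j) \<le> opnorm A ^ k" for i j
  proof -
    have "matpow A k $ i $ j = (matpow A k *v axis j 1) $ i"
      by (simp add: matrix_vector_mult_def axis_def if_distrib cong: if_cong)
    also have "norm \<dots> \<le> norm (matpow A k *v axis j 1)"
      by (rule Finite_Cartesian_Product.norm_nth_le)
    also have "\<dots> \<le> opnorm A ^ k * norm (axis j 1 :: complex^'n)"
      by (rule norm_matpow_vec)
    finally show ?thesis by (simp add: norm_eq_sqrt_inner[of "axis j 1"] inner_axis_axis)
  qed
  have "norm (matpow A k) \<le> (\<Sum>i\<in>UNIV. norm (matpow A k $ i))"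
    unfolding norm_vec_def[of "matpow A k"] by (rule L2_set_le_sum) simp
  also have "\<dots> \<le> (\<Sum>i\<in>(UNIV::'n set). \<Sum>j\<in>(UNIV::'n set). norm (matpow A k $ i $ j))"
    unfolding norm_vec_def[of "matpow A k $ _"] by (intro sum_mono L2_set_le_sum) simp
  also have "\<dots> \<le> (\<Sum>i\<in>(UNIV::'n set). \<Sum>j\<in>(UNIV::'n set). opnorm A ^ k)"
    by (intro sum_mono entry)
  finally show ?thesis by simp
qed

lemma matexp_sums: "(\<lambda>k. (1 / fact k) *\<^sub>R matpow A k) sums matexp A"
  for A :: "complex^'n^'n"
proof -
  have "summable (\<lambda>k. real (CARD('n) * CARD('n)) * (inverse (fact k) * opnorm A ^ k))"
    by (intro summable_mult summable_exp)
  then have "summable (\<lambda>k. (1 / fact k) *\<^sub>R matpow A k)"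
  proof (rule summable_comparison_test[rotated], intro exI allI impI)
    fix k
    have "norm ((1 / fact k) *\<^sub>R matpow A k) = inverse (fact k) * norm (matpow A k)"
      by (simp add: inverse_eq_divide)
    also have "\<dots> \<le> inverse (fact k) * (real (CARD('n) * CARD('n)) * opnorm A ^ k)"
      by (intro mult_left_mono norm_matpow_le) simp
    finally show "norm ((1 / fact k) *\<^sub>R matpow A k)
        \<le> real (CARD('n) * CARD('n)) * (inverse (fact k) * opnorm A ^ k)"
      by (simp only: mult.left_commute)
  qed
  then show ?thesis
    unfolding matexp_def by (rule summable_sums)
qed

end

theory Submission
  imports Defs
begin

text \<open>
  The rotation by \<open>b\<close> in the upper left block of \<open>M a b\<close> is diagonalised by the vectors \<open>(1, \<plusminus>\<i>)\<close>.
  This splits \<open>\<complex>\<^sup>4\<close> into two orthogonal invariant planes, the sectors \<open>\<sigma> = \<plusminus>\<i>\<close>, on which \<open>M a b\<close>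
  acts as the \<open>2 \<times> 2\<close> matrix with rows \<open>(1 + \<sigma>b, \<surd>a)\<close> and \<open>(-\<surd>a, 0)\<close>. The two matrices are complex
  conjugates of each other, so both restrictions of the semigroup have the same norm. For
  \<open>\<sigma> = -\<i>\<close> the eigenvalues are \<open>(1 - \<i>b \<plusminus> c) / 2\<close>, and with the spectral projections \<open>P\<close> and
  \<open>Q = 1 - P\<close> the semigroup is a scalar of modulus \<open>exp (- t (1 - c1) / 2)\<close> times \<open>P + z Q\<close>, where
  \<open>z = exp (- t c)\<close> and \<open>\<bar>z\<bar> = r = exp (- c1 t)\<close> (\<open>matexp_M_sector\<close>). The prefactor in the theorem is \<open>1 / \<parallel>P\<parallel>\<close>:
  for \<open>p = \<parallel>P\<parallel>\<^sup>2\<close> one finds \<open>p = (c2\<^sup>2 + 1) / (c1\<^sup>2 + c2\<^sup>2)\<close>.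

  The triangle inequality would give only an error \<open>r\<close>. The small factor in front of \<open>r\<close> comes from
  comparing squares. The squared Frobenius norm \<open>F\<close> of \<open>P + z Q\<close> is
  \<open>p (1 + r\<^sup>2) - 2 (p - 1) Re z\<close>, because \<open>P\<close> and \<open>Q\<close> have Frobenius inner product \<open>1 - p\<close>; it bounds the
  squared operator norm from above (\<open>Frobenius_bound\<close>). The unit vector on which \<open>P\<close> attains its norm bounds it
  from below by \<open>F - r\<^sup>2\<close> (\<open>test_vector\<close>). Dividing by \<open>p\<close>, the squared ratio of norms
  differs from \<open>1\<close> by at most \<open>r\<^sup>2 + 2 \<delta> r\<close> with \<open>\<delta> = 1 - 1 / p\<close>.

  Finally \<open>\<delta>\<close> is small for large \<open>b\<close>. The real and imaginary parts of \<open>c\<^sup>2\<close> give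
  \<open>(1 - c1\<^sup>2) (1 + c2\<^sup>2) = 4 a\<close>, whence \<open>\<delta> = 4 a / (1 + c2\<^sup>2)\<^sup>2 \<le> 4 a / b\<^sup>4\<close>. So
  \<open>opnorm_semigroup_asymptotic\<close> holds for every \<open>t\<close>, with an explicit constant.
\<close>

section \<open>The matrix exponential on eigenvectors\<close>

lemma matpow_eigenvector:
  fixes A :: "complex^'n^'n"
  assumes "A *v x = l *s x"
  shows "matpow A k *v x = l ^ k *s x"
proof (induction k)
  case (Suc k)
  have "matpow A (Suc k) *v x = A *v (l ^ k *s x)"
    by (simp add: matrix_vector_mul_assoc[symmetric] Suc)
  also have "\<dots> = l ^ k *s (A *v x)"
    by (simp add: vector_scalar_commute)
  finally show ?case by (simp add: assms vector_smult_assoc mult.commute)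
qed simp

text \<open>
  This lets the exponential of a diagonalisable matrix be read off from an eigenvector
  decomposition of its argument, without a functional calculus for matrices.
\<close>

lemma matexp_eigenvector:
  fixes A :: "complex^'n^'n"
  assumes "A *v x = l *s x"
  shows "matexp A *v x = exp l *s x"
proof -
  have lin: "bounded_linear (\<lambda>X :: complex^'n^'n. X *v x)"
    unfolding linear_conv_bounded_linear[symmetric]
    by (intro linearI)
      (simp_all add: vec_eq_iff matrix_vector_mult_def scaleR_sum_right sum.distrib ring_distribs)
  have "(\<lambda>k. ((1 / fact k) *\<^sub>R matpow A k) *v x) sums (matexp A *v x)"
    by (rule bounded_linear.sums[OF lin matexp_sums])
  moreover have "((1 / fact k) *\<^sub>R matpow A k) *v x = (l ^ k /\<^sub>R fact k) *s x" for k
    using matpow_eigenvector[OF assms, of k]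
    by (simp add: linear_cmul[OF bounded_linear.linear[OF lin]] vec_eq_iff divide_inverse)
  ultimately have s: "(\<lambda>k. (l ^ k /\<^sub>R fact k) *s x) sums (matexp A *v x)" by simp
  have "(matexp A *v x) $ i = exp l * x $ i" for i
  proof (rule sums_unique2)
    show "(\<lambda>k. ((l ^ k /\<^sub>R fact k) *s x) $ i) sums ((matexp A *v x) $ i)"
      by (rule bounded_linear.sums[OF bounded_linear_vec_nth s])
    show "(\<lambda>k. ((l ^ k /\<^sub>R fact k) *s x) $ i) sums (exp l * x $ i)"
      unfolding vector_smult_component by (intro sums_mult2 exp_converges)
  qed
  then show ?thesis by (simp add: vec_eq_iff)
qed

section \<open>Reduction to two-by-two matrices\<close>

text \<open>
  The tensor product of \<open>(x, y)\<close> with \<open>(1, \<sigma>)\<close>. For \<open>\<sigma> = \<plusminus>\<i>\<close>, the vector \<open>(1, \<sigma>)\<close> is an eigenvector of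
  the rotation block of \<open>M a b\<close>.
\<close>

definition sector :: "complex \<Rightarrow> complex \<Rightarrow> complex \<Rightarrow> complex^4" where
  "sector \<sigma> x y = vector [x, \<sigma> * x, y, \<sigma> * y]"

lemma norm_square_4: "(norm v)\<^sup>2 = (cmod (v$1))\<^sup>2 + (cmod (v$2))\<^sup>2 + (cmod (v$3))\<^sup>2 + (cmod (v$4))\<^sup>2"
  for v :: "complex^4"
  by (simp add: norm_vec_def L2_set_def sum_4)

lemma norm_square_sector:
  "cmod \<sigma> = 1 \<Longrightarrow> (norm (sector \<sigma> x y))\<^sup>2 = 2 * ((cmod x)\<^sup>2 + (cmod y)\<^sup>2)"
  by (simp add: norm_square_4 sector_def vector_4 norm_mult)

lemma smult_sector: "k *s sector \<sigma> x y = sector \<sigma> (k * x) (k * y)"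
  by (simp add: vec_eq_iff forall_4 sector_def vector_4)

lemma add_sector: "sector \<sigma> x y + sector \<sigma> x' y' = sector \<sigma> (x + x') (y + y')"
  by (simp add: vec_eq_iff forall_4 sector_def vector_4 algebra_simps)

lemma sector_decomposition:
  "\<exists>x y x' y'. v = sector \<i> x y + sector (-\<i>) x' y'"
proof (intro exI)
  show "v = sector \<i> ((v$1 - \<i> * v$2) / 2) ((v$3 - \<i> * v$4) / 2)
          + sector (-\<i>) ((v$1 + \<i> * v$2) / 2) ((v$3 + \<i> * v$4) / 2)"
    by (simp add: vec_eq_iff forall_4 sector_def vector_4 field_simps)
qed

text \<open>
  Since the two sectors are orthogonal, bounds on each of them combine with no loss of constant.
\<close>

lemma norm_square_sector_sum:
  "(norm (sector \<i> x y + sector (-\<i>) x' y'))\<^sup>2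
    = 2 * ((cmod x)\<^sup>2 + (cmod y)\<^sup>2 + (cmod x')\<^sup>2 + (cmod y')\<^sup>2)"
  by (simp add: norm_square_4 sector_def vector_4 cmod_power2)
    (simp add: power2_eq_square algebra_simps)

lemma M_sector:
  fixes \<sigma> x y :: complex and a b :: real
  assumes "\<sigma>\<^sup>2 = -1"
  shows "M a b *v sector \<sigma> x y
    = sector \<sigma> ((1 + \<sigma> * b) * x + sqrt a * y) (- sqrt a * x)"
proof -
  have "\<sigma> * ((1 + \<sigma> * b) * x + sqrt a * y) = \<sigma> * x + \<sigma>\<^sup>2 * (b * x) + \<sigma> * (sqrt a * y)"
    by (simp add: power2_eq_square algebra_simps)
  also have "\<dots> = - (b * x) + \<sigma> * x + sqrt a * (\<sigma> * y)"
    unfolding assms by simp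
  finally have eq: "\<sigma> * ((1 + \<sigma> * b) * x + sqrt a * y) = - (b * x) + \<sigma> * x + sqrt a * (\<sigma> * y)" .
  show ?thesis
    unfolding vec_eq_iff forall_4 sector_def vector_4 eq
    by (simp add: M_def matrix_vector_mult_def sum_4 vector_4) (simp add: algebra_simps)
qed

text \<open>
  The new components are \<open>P + z Q\<close> applied to \<open>(x, y)\<close>, with \<open>2 P\<close> having rows \<open>(1 - m, -n)\<close> and \<open>(n, 1 + m)\<close>, and
  \<open>Q = 1 - P\<close>. The equation for \<open>c\<close> says \<open>m\<^sup>2 - n\<^sup>2 = 1\<close>, which makes \<open>P\<close> and \<open>Q\<close> the projections onto
  the eigenspaces for \<open>(1 + \<sigma>b - c) / 2\<close> and \<open>(1 + \<sigma>b + c) / 2\<close>. Since \<open>\<sigma>\<close> is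
  left open, the same formula serves one sector with the root \<open>c\<close> and the other with \<open>cnj c\<close>.
\<close>

lemma matexp_M_sector:
  fixes a b t :: real and c \<sigma> :: complex
  assumes "a \<ge> 0" and \<sigma>: "\<sigma>\<^sup>2 = -1" and c: "c \<noteq> 0" "c\<^sup>2 = (1 + \<sigma> * b)\<^sup>2 - 4 * a"
  defines "m \<equiv> (1 + \<sigma> * b) / c" and "n \<equiv> 2 * sqrt a / c"
    and "z \<equiv> exp (- t * c)" and "g \<equiv> exp (- t * (1 + \<sigma> * b - c) / 2)"
  shows "matexp ((- t) *\<^sub>R M a b) *v sector \<sigma> x y
    = g *s sector \<sigma> ((((1 + z) - (1 - z) * m) * x - (1 - z) * n * y) / 2)
        (((1 - z) * n * x + ((1 + z) + (1 - z) * m) * y) / 2)"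
proof -
  define s where "s = complex_of_real (sqrt a)"
  define w where "w = 1 + \<sigma> * b"
  have ss: "s * s = a" using \<open>a \<ge> 0\<close> by (simp add: s_def flip: of_real_mult)
  have w: "w = m * c" and s: "s = n * c / 2" using c by (simp_all add: w_def m_def n_def s_def)
  have cc: "c * c = w * w - 4 * (s * s)" using c ss by (simp add: power2_eq_square w_def)
  then have "m * m * (c * c) = (1 + n * n) * (c * c)" unfolding w s by (simp add: algebra_simps)
  then have mn: "m * m = 1 + n * n" using c by simp
  have step: "matexp ((- t) *\<^sub>R M a b) *v sector \<sigma> x y = exp (- t * l) *s sector \<sigma> x y"
    if "w * x + s * y = l * x" "- s * x = l * y" for x y l :: complex
  proof (rule matexp_eigenvector)
    have "((- t) *\<^sub>R M a b) *v sector \<sigma> x y = (- complex_of_real t) *s (M a b *v sector \<sigma> x y)"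
      by (simp add: vec_eq_iff matrix_vector_mult_def sum_4)
        (simp add: scaleR_conv_of_real algebra_simps)
    also have "M a b *v sector \<sigma> x y = sector \<sigma> (l * x) (l * y)"
      using that by (simp add: M_sector[OF \<sigma>] w_def s_def)
    finally show "((- t) *\<^sub>R M a b) *v sector \<sigma> x y = (- t * l) *s sector \<sigma> x y"
      by (simp add: smult_sector mult.assoc)
  qed
  \<comment> \<open>The components of the vector in the two eigenspaces.\<close>
  define X Y where "X = ((1 - m) * x - n * y) / 2" and "Y = (n * x + (1 + m) * y) / 2"
  define X' Y' where "X' = ((1 + m) * x + n * y) / 2" and "Y' = (- n * x + (1 - m) * y) / 2"
  have e1: "matexp ((- t) *\<^sub>R M a b) *v sector \<sigma> X Y = g *s sector \<sigma> X Y"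
  proof -
    have "(m + 1) * X + n * Y = (1 + n * n - m * m) / 2 * x"
      "n * X + (m - 1) * Y = (m * m - (1 + n * n)) / 2 * y"
      unfolding X_def Y_def by (simp_all add: field_simps)
    then have "(m + 1) * X + n * Y = 0" "n * X + (m - 1) * Y = 0" using mn by simp_all
    moreover have "w * X + s * Y = (w - c) / 2 * X + c / 2 * ((m + 1) * X + n * Y)"
      "- s * X = (w - c) / 2 * Y - c / 2 * (n * X + (m - 1) * Y)"
      unfolding w s by (simp_all add: field_simps)
    ultimately have "w * X + s * Y = (w - c) / 2 * X" "- s * X = (w - c) / 2 * Y" by simp_all
    from step[OF this] show ?thesis by (simp add: g_def w_def)
  qed
  have e2: "matexp ((- t) *\<^sub>R M a b) *v sector \<sigma> X' Y' = (g * z) *s sector \<sigma> X' Y'"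
  proof -
    have "(m - 1) * X' + n * Y' = (m * m - (1 + n * n)) / 2 * x"
      "n * X' + (m + 1) * Y' = (1 + n * n - m * m) / 2 * y"
      unfolding X'_def Y'_def by (simp_all add: field_simps)
    then have "(m - 1) * X' + n * Y' = 0" "n * X' + (m + 1) * Y' = 0" using mn by simp_all
    moreover have "w * X' + s * Y' = (w + c) / 2 * X' + c / 2 * ((m - 1) * X' + n * Y')"
      "- s * X' = (w + c) / 2 * Y' - c / 2 * (n * X' + (m + 1) * Y')"
      unfolding w s by (simp_all add: field_simps)
    ultimately have "w * X' + s * Y' = (w + c) / 2 * X'" "- s * X' = (w + c) / 2 * Y'" by simp_all
    from step[OF this] show ?thesis
      by (simp add: g_def z_def w_def field_simps flip: exp_add)
  qed
  have "X + X' = x" "Y + Y' = y"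
    unfolding X_def Y_def X'_def Y'_def by (simp_all add: field_simps)
  then have "sector \<sigma> x y = sector \<sigma> X Y + sector \<sigma> X' Y'" by (simp add: add_sector)
  then have "matexp ((- t) *\<^sub>R M a b) *v sector \<sigma> x y
      = g *s sector \<sigma> X Y + (g * z) *s sector \<sigma> X' Y'"
    by (simp only: matrix_vector_right_distrib e1 e2)
  also have "\<dots> = g *s sector \<sigma> (X + z * X') (Y + z * Y')"
    by (simp add: smult_sector add_sector distrib_left mult.assoc)
  finally have "matexp ((- t) *\<^sub>R M a b) *v sector \<sigma> x y
      = g *s sector \<sigma> (X + z * X') (Y + z * Y')" .
  moreover have "X + z * X' = (((1 + z) - (1 - z) * m) * x - (1 - z) * n * y) / 2"
    "Y + z * Y' = ((1 - z) * n * x + ((1 + z) + (1 - z) * m) * y) / 2"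
    unfolding X_def Y_def X'_def Y'_def by (simp_all add: field_simps)
  ultimately show ?thesis by (simp only:)
qed

section \<open>Norm bounds for two-by-two matrices\<close>

lemma cmod_square_row:
  "(cmod (\<alpha> * x + \<beta> * y))\<^sup>2 \<le> ((cmod \<alpha>)\<^sup>2 + (cmod \<beta>)\<^sup>2) * ((cmod x)\<^sup>2 + (cmod y)\<^sup>2)"
proof -
  have "(cmod (\<alpha> * x + \<beta> * y))\<^sup>2 \<le> (cmod \<alpha> * cmod x + cmod \<beta> * cmod y)\<^sup>2"
    by (intro power_mono) (metis norm_mult norm_triangle_ineq, simp)
  also have "\<dots> \<le> \<dots> + (cmod \<alpha> * cmod y - cmod \<beta> * cmod x)\<^sup>2" by simp
  also have "\<dots> = ((cmod \<alpha>)\<^sup>2 + (cmod \<beta>)\<^sup>2) * ((cmod x)\<^sup>2 + (cmod y)\<^sup>2)"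
    by (simp add: power2_eq_square algebra_simps)
  finally show ?thesis .
qed

text \<open>
  Here \<open>F\<close> is the squared Frobenius norm of \<open>P + z Q\<close>: the two diagonal entries are
  \<open>(1 + z) \<plusminus> (1 - z) m\<close> up to a factor \<open>1 / 2\<close>, and the parallelogram law removes their cross terms.
\<close>

lemma Frobenius_bound:
  fixes m n z x y :: complex
  defines "F \<equiv> ((cmod (1 + z))\<^sup>2 + ((cmod m)\<^sup>2 + (cmod n)\<^sup>2) * (cmod (1 - z))\<^sup>2) / 2"
  shows "(cmod ((((1 + z) - (1 - z) * m) * x - (1 - z) * n * y) / 2))\<^sup>2
      + (cmod (((1 - z) * n * x + ((1 + z) + (1 - z) * m) * y) / 2))\<^sup>2
    \<le> F * ((cmod x)\<^sup>2 + (cmod y)\<^sup>2)"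
proof -
  define u v where "u = 1 + z" and "v = 1 - z"
  have par: "(cmod (u - v * m))\<^sup>2 + (cmod (u + v * m))\<^sup>2 = 2 * (cmod u)\<^sup>2 + 2 * (cmod v)\<^sup>2 * (cmod m)\<^sup>2"
    by (simp add: cmod_power2) (simp add: power2_eq_square algebra_simps)
  have "(cmod ((u - v * m) * x - v * n * y))\<^sup>2 + (cmod (v * n * x + (u + v * m) * y))\<^sup>2
     \<le> ((cmod (u - v * m))\<^sup>2 + (cmod (v * n))\<^sup>2) * ((cmod x)\<^sup>2 + (cmod y)\<^sup>2)
      + ((cmod (v * n))\<^sup>2 + (cmod (u + v * m))\<^sup>2) * ((cmod x)\<^sup>2 + (cmod y)\<^sup>2)"
    using cmod_square_row[of "u - v * m" x "- (v * n)" y] cmod_square_row[of "v * n" x "u + v * m" y]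
    by simp
  also have "\<dots> = (((cmod (u - v * m))\<^sup>2 + (cmod (u + v * m))\<^sup>2) + 2 * (cmod (v * n))\<^sup>2)
      * ((cmod x)\<^sup>2 + (cmod y)\<^sup>2)"
    by (simp add: algebra_simps)
  also have "\<dots> = 4 * (F * ((cmod x)\<^sup>2 + (cmod y)\<^sup>2))"
    unfolding par F_def u_def[symmetric] v_def[symmetric]
    by (simp add: norm_mult power_mult_distrib algebra_simps)
  finally show ?thesis
    unfolding u_def v_def by (simp add: norm_divide power_divide)
qed

text \<open>
  The vector \<open>v = (x, y)\<close> is the conjugate of a row of \<open>2 P\<close>. As \<open>P\<close> has rank one, \<open>v\<close> spans the
  orthogonal complement of its kernel, so \<open>\<parallel>P v\<parallel>\<^sup>2 = p \<parallel>v\<parallel>\<^sup>2\<close>; and \<open>\<langle>P v, v\<rangle> = \<parallel>v\<parallel>\<^sup>2\<close>, because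
  \<open>P v - v\<close> lies in that kernel. Expanding the square of \<open>(P + z Q) v = (1 - z) P v + z v\<close>
  gives the identity.
\<close>

lemma test_vector:
  fixes m n z :: complex
  assumes mn: "m\<^sup>2 - n\<^sup>2 = 1" and n0: "n \<noteq> 0"
  defines "p \<equiv> (1 + (cmod m)\<^sup>2 + (cmod n)\<^sup>2) / 2"
    and "x \<equiv> cnj n" and "y \<equiv> cnj (1 + m)"
  shows "(cmod ((((1 + z) - (1 - z) * m) * x - (1 - z) * n * y) / 2))\<^sup>2
      + (cmod (((1 - z) * n * x + ((1 + z) + (1 - z) * m) * y) / 2))\<^sup>2
    = (p * (cmod (1 - z))\<^sup>2 + 2 * Re z - (cmod z)\<^sup>2) * ((cmod x)\<^sup>2 + (cmod y)\<^sup>2)"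
proof -
  define Y where "Y = (cmod x)\<^sup>2 + (cmod y)\<^sup>2"
  \<comment> \<open>The rows of \<open>2 P\<close> are \<open>- k\<close> and \<open>1\<close> times the row \<open>(n, 1 + m)\<close>.\<close>
  define k where "k = n / (1 + m)"
  have n2: "n\<^sup>2 = (m - 1) * (1 + m)" using mn by (simp add: power2_eq_square algebra_simps)
  have m1: "1 + m \<noteq> 0" using n2 n0 by auto
  have n: "n = k * (1 + m)" and mk: "m - 1 = k * n"
    using m1 n2 by (auto simp: k_def field_simps power2_eq_square)
  have Y1: "Y = (1 + (cmod k)\<^sup>2) * (cmod (1 + m))\<^sup>2"
    unfolding Y_def x_def y_def complex_mod_cnj
    by (subst n) (simp only: norm_mult power_mult_distrib distrib_right mult_1 add.commute)
  have Yc: "complex_of_real Y = n * x + (1 + m) * y"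
    unfolding Y_def x_def y_def of_real_add complex_mod_cnj complex_norm_square by simp
  have p: "4 * p = (1 + (cmod k)\<^sup>2) * Y"
  proof -
    have "4 * p = (cmod (1 + m))\<^sup>2 + (cmod (m - 1))\<^sup>2 + 2 * (cmod n)\<^sup>2"
      unfolding p_def by (simp add: cmod_power2) (simp add: power2_eq_square algebra_simps)
    also have "\<dots> = (1 + (cmod k)\<^sup>2) * (1 + (cmod k)\<^sup>2) * (cmod (1 + m))\<^sup>2"
    proof -
      have "(cmod (m - 1))\<^sup>2 = (cmod k)\<^sup>2 * (cmod n)\<^sup>2" "(cmod n)\<^sup>2 = (cmod k)\<^sup>2 * (cmod (1 + m))\<^sup>2"
        by (metis mk norm_mult power_mult_distrib, metis n norm_mult power_mult_distrib)
      then show ?thesis by (simp only:) (simp add: algebra_simps)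
    qed
    finally show ?thesis by (simp add: Y1)
  qed
  have r1: "(((1 + z) - (1 - z) * m) * x - (1 - z) * n * y) / 2 = z * x - (1 - z) * k * (Y / 2)"
  proof -
    have "k * Y = (k * n) * x + (k * (1 + m)) * y" unfolding Yc by (simp add: algebra_simps)
    then have "k * Y = (m - 1) * x + n * y" unfolding mk[symmetric] n[symmetric] .
    then have "z * x - (1 - z) * k * (Y / 2) = z * x - (1 - z) * ((m - 1) * x + n * y) / 2" by simp
    then show ?thesis by (simp add: field_simps)
  qed
  have r2: "((1 - z) * n * x + ((1 + z) + (1 - z) * m) * y) / 2 = z * y + (1 - z) * (Y / 2)"
    by (simp add: Yc field_simps)
  have sq: "(cmod (u + v))\<^sup>2 = (cmod u)\<^sup>2 + (cmod v)\<^sup>2 + 2 * Re (cnj u * v)" for u v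
    by (simp add: cmod_power2) (simp add: power2_eq_square algebra_simps)
  have cross: "cnj (z * x) * (- ((1 - z) * k * (Y / 2))) + cnj (z * y) * ((1 - z) * (Y / 2))
      = cnj z * (1 - z) * Y"
  proof -
    have "cnj (z * x) * (- ((1 - z) * k * H)) + cnj (z * y) * ((1 - z) * H)
        = cnj z * (1 - z) * (H * (1 + m - k * n))" for H
      by (simp add: x_def y_def algebra_simps)
    moreover have "1 + m - k * n = 2" by (simp flip: mk)
    ultimately show ?thesis by (simp only: of_real_divide of_real_numeral) simp
  qed
  have "(cmod (z * x - (1 - z) * k * (Y / 2)))\<^sup>2 + (cmod (z * y + (1 - z) * (Y / 2)))\<^sup>2
      = ((cmod (z * x))\<^sup>2 + (cmod (z * y))\<^sup>2)
        + ((cmod ((1 - z) * k * (Y / 2)))\<^sup>2 + (cmod ((1 - z) * (Y / 2)))\<^sup>2)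
        + 2 * Re (cnj z * (1 - z) * Y)"
    unfolding cross[symmetric] diff_conv_add_uminus[of "z * x"] sq by simp
  also have "(cmod (z * x))\<^sup>2 + (cmod (z * y))\<^sup>2 = (cmod z)\<^sup>2 * Y"
    by (simp add: Y_def norm_mult power_mult_distrib algebra_simps)
  also have "(cmod ((1 - z) * k * (Y / 2)))\<^sup>2 + (cmod ((1 - z) * (Y / 2)))\<^sup>2
      = (cmod (1 - z))\<^sup>2 * ((1 + (cmod k)\<^sup>2) * Y) * Y / 4"
    by (simp add: norm_mult norm_divide power_mult_distrib power_divide)
      (simp add: power2_eq_square field_simps)
  also have "(cmod z)\<^sup>2 * Y + (cmod (1 - z))\<^sup>2 * ((1 + (cmod k)\<^sup>2) * Y) * Y / 4
        + 2 * Re (cnj z * (1 - z) * Y)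
      = (p * (cmod (1 - z))\<^sup>2 + (cmod z)\<^sup>2 + 2 * Re (cnj z * (1 - z))) * Y"
  proof -
    have "q * Y + v * (4 * p) * Y / 4 + 2 * Re (w * complex_of_real Y) = (p * v + q + 2 * Re w) * Y"
      for q v :: real and w
      by (simp add: algebra_simps)
    then show ?thesis unfolding p[symmetric] .
  qed
  also have "\<dots> = (p * (cmod (1 - z))\<^sup>2 + 2 * Re z - (cmod z)\<^sup>2) * Y"
  proof -
    have "Re (cnj z * (1 - z)) = Re z - (cmod z)\<^sup>2"
      by (simp add: cmod_power2) (simp add: power2_eq_square algebra_simps)
    then show ?thesis by (simp only:) (simp add: algebra_simps)
  qed
  finally show ?thesis unfolding r1 r2 Y_def .
qed

section \<open>The norm of the semigroup\<close>

text \<open>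
  The bounds depend on \<open>m\<close> and \<open>n\<close> only through their moduli, which are the same in both
  sectors, and \<open>\<gamma>\<close> is the squared modulus of the scalar factor. The identity
  \<open>F = p \<bar>1 - z\<bar>\<^sup>2 + 2 Re z\<close> rewrites the squared Frobenius norm in terms of \<open>p\<close>, so that the upper and the lower
  bound are seen to differ by \<open>\<bar>z\<bar>\<^sup>2\<close> only.
\<close>

lemma matexp_sector_image:
  fixes a b t :: real and c \<sigma> :: complex
  assumes a: "a > 0" and \<sigma>: "\<sigma> = \<i> \<or> \<sigma> = -\<i>" and c: "c \<noteq> 0" "c\<^sup>2 = (1 + \<sigma> * b)\<^sup>2 - 4 * a"
  defines "z \<equiv> exp (- t * c)"
    and "p \<equiv> (1 + (1 + b\<^sup>2 + 4 * a) / (cmod c)\<^sup>2) / 2"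
    and "\<gamma> \<equiv> exp (- t * (1 - Re c))"
  defines "F \<equiv> p * (cmod (1 - z))\<^sup>2 + 2 * Re z"
  shows "\<exists>X Y. matexp ((- t) *\<^sub>R M a b) *v sector \<sigma> x y = sector \<sigma> X Y \<and>
      (cmod X)\<^sup>2 + (cmod Y)\<^sup>2 \<le> \<gamma> * F * ((cmod x)\<^sup>2 + (cmod y)\<^sup>2)" (is ?upper)
    and "\<exists>x y X Y. sector \<sigma> x y \<noteq> 0 \<and> matexp ((- t) *\<^sub>R M a b) *v sector \<sigma> x y = sector \<sigma> X Y \<and>
      (cmod X)\<^sup>2 + (cmod Y)\<^sup>2 = \<gamma> * (F - (cmod z)\<^sup>2) * ((cmod x)\<^sup>2 + (cmod y)\<^sup>2)" (is ?lower)
proof -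
  define m n where "m = (1 + \<sigma> * b) / c" and "n = 2 * complex_of_real (sqrt a) / c"
  define g where "g = exp (- t * (1 + \<sigma> * b - c) / 2)"
  define X Y where "X x y = (((1 + z) - (1 - z) * m) * x - (1 - z) * n * y) / 2"
    and "Y x y = ((1 - z) * n * x + ((1 + z) + (1 - z) * m) * y) / 2" for x y
  have \<sigma>2: "\<sigma>\<^sup>2 = -1" using \<sigma> by auto
  have image: "matexp ((- t) *\<^sub>R M a b) *v sector \<sigma> x y = sector \<sigma> (g * X x y) (g * Y x y)" for x y
    using matexp_M_sector[OF _ \<sigma>2 c] a
    by (simp add: m_def n_def g_def z_def X_def Y_def smult_sector)
  have g: "(cmod g)\<^sup>2 = \<gamma>"
    using \<sigma> by (auto simp: g_def \<gamma>_def exp_double[symmetric] field_simps)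
  have mn: "(cmod m)\<^sup>2 + (cmod n)\<^sup>2 = (1 + b\<^sup>2 + 4 * a) / (cmod c)\<^sup>2"
  proof -
    have "(cmod (1 + \<sigma> * b))\<^sup>2 = 1 + b\<^sup>2" using \<sigma> by (auto simp: cmod_power2)
    then show ?thesis using a
      by (simp only: m_def n_def norm_divide power_divide)
        (simp add: norm_mult power_mult_distrib flip: add_divide_distrib)
  qed
  have p: "p = (1 + (cmod m)\<^sup>2 + (cmod n)\<^sup>2) / 2" by (simp add: p_def mn add.assoc)
  have F: "F = ((cmod (1 + z))\<^sup>2 + ((cmod m)\<^sup>2 + (cmod n)\<^sup>2) * (cmod (1 - z))\<^sup>2) / 2"
    unfolding F_def p by (simp add: cmod_power2) (simp add: power2_eq_square field_simps)
  have scale: "(cmod (g * u))\<^sup>2 + (cmod (g * v))\<^sup>2 = \<gamma> * ((cmod u)\<^sup>2 + (cmod v)\<^sup>2)" for u v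
    by (simp add: norm_mult power_mult_distrib g algebra_simps)
  have "(cmod (X x y))\<^sup>2 + (cmod (Y x y))\<^sup>2 \<le> F * ((cmod x)\<^sup>2 + (cmod y)\<^sup>2)"
    unfolding X_def Y_def F by (rule Frobenius_bound)
  then have "(cmod (g * X x y))\<^sup>2 + (cmod (g * Y x y))\<^sup>2 \<le> \<gamma> * F * ((cmod x)\<^sup>2 + (cmod y)\<^sup>2)"
    unfolding scale by (simp add: \<gamma>_def mult.assoc)
  then show ?upper using image by blast
  have n0: "n \<noteq> 0" using a c by (simp add: n_def)
  have m2n2: "m\<^sup>2 - n\<^sup>2 = 1"
  proof -
    have "n\<^sup>2 = 4 * a / c\<^sup>2"
      using a by (simp add: n_def power_divide power_mult_distrib flip: of_real_power)
    then have "m\<^sup>2 - n\<^sup>2 = ((1 + \<sigma> * b)\<^sup>2 - 4 * a) / c\<^sup>2"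
      by (simp add: m_def power_divide diff_divide_distrib)
    also have "(1 + \<sigma> * b)\<^sup>2 - 4 * a = c\<^sup>2" using c(2) by simp
    finally show ?thesis using c(1) by simp
  qed
  define x0 y0 where "x0 = cnj n" and "y0 = cnj (1 + m)"
  have "(cmod (X x0 y0))\<^sup>2 + (cmod (Y x0 y0))\<^sup>2
      = (F - (cmod z)\<^sup>2) * ((cmod x0)\<^sup>2 + (cmod y0)\<^sup>2)"
    unfolding X_def Y_def x0_def y0_def F_def p using test_vector[OF m2n2 n0, of z] by simp
  then have "(cmod (g * X x0 y0))\<^sup>2 + (cmod (g * Y x0 y0))\<^sup>2
      = \<gamma> * (F - (cmod z)\<^sup>2) * ((cmod x0)\<^sup>2 + (cmod y0)\<^sup>2)"
    unfolding scale by simp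
  moreover have "sector \<sigma> x0 y0 \<noteq> 0"
    using n0 by (auto simp: vec_eq_iff forall_4 sector_def vector_4 x0_def)
  ultimately show ?lower using image by blast
qed

lemma opnorm_semigroup_bounds:
  fixes a b t :: real and c :: complex
  assumes a: "a > 0" and c: "c \<noteq> 0" "c\<^sup>2 = A_coeff a b"
  defines "z \<equiv> exp (- t * c)"
    and "p \<equiv> (1 + (1 + b\<^sup>2 + 4 * a) / (cmod c)\<^sup>2) / 2"
  defines "F \<equiv> p * (cmod (1 - z))\<^sup>2 + 2 * Re z"
    and "N \<equiv> exp (t * (1 - Re c) / 2) * opnorm (matexp ((- t) *\<^sub>R M a b))"
  shows "F - (cmod z)\<^sup>2 \<le> N\<^sup>2" "N\<^sup>2 \<le> F"
proof -
  let ?T = "matexp ((- t) *\<^sub>R M a b)"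
  define \<gamma> where "\<gamma> = exp (- t * (1 - Re c))"
  have \<gamma>: "N\<^sup>2 = (opnorm ?T)\<^sup>2 / \<gamma>" "\<gamma> > 0"
  proof -
    have "N\<^sup>2 = (exp (t * (1 - Re c) / 2))\<^sup>2 * (opnorm ?T)\<^sup>2"
      unfolding N_def by (rule power_mult_distrib)
    also have "(exp (t * (1 - Re c) / 2))\<^sup>2 = exp (t * (1 - Re c))"
      unfolding exp_double[symmetric] by simp
    also have "exp (t * (1 - Re c)) = inverse \<gamma>"
      unfolding \<gamma>_def exp_minus[symmetric] by simp
    finally show "N\<^sup>2 = (opnorm ?T)\<^sup>2 / \<gamma>"
      by (simp only: divide_inverse mult.commute)
  qed (simp add: \<gamma>_def)
  \<comment> \<open>The root \<open>c\<close> belongs to the sector \<open>-\<i>\<close>; the sector \<open>\<i>\<close> has its conjugate.\<close>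
  have cm: "c\<^sup>2 = (1 + (-\<i>) * b)\<^sup>2 - 4 * a"
    unfolding c A_coeff_def by (simp add: power2_eq_square algebra_simps)
  have cp: "(cnj c)\<^sup>2 = (1 + \<i> * b)\<^sup>2 - 4 * a"
    using arg_cong[OF cm, of cnj] by simp
  have z': "exp (- t * cnj c) = cnj z" by (simp add: z_def exp_cnj)
  have z1: "cmod (1 - cnj z) = cmod (1 - z)"
    by (metis complex_cnj_diff complex_cnj_one complex_mod_cnj)
  have pos: "0 \<le> opnorm ?T" by (simp add: opnorm_def onorm_pos_le)
  note minus = matexp_sector_image[OF a disjI2[OF refl] c(1) cm, of t,
      folded z_def p_def \<gamma>_def, folded F_def]
  have plus: "\<exists>X Y. ?T *v sector \<i> x y = sector \<i> X Y \<and>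
      (cmod X)\<^sup>2 + (cmod Y)\<^sup>2 \<le> \<gamma> * F * ((cmod x)\<^sup>2 + (cmod y)\<^sup>2)" for x y
    using matexp_sector_image(1)[OF a disjI1[OF refl] _ cp, of t x y] c(1)
    unfolding z' by (simp add: z1 F_def p_def \<gamma>_def)
  have upper: "(norm (?T *v v))\<^sup>2 \<le> \<gamma> * F * (norm v)\<^sup>2" for v
  proof -
    obtain x y x' y' where v: "v = sector \<i> x y + sector (-\<i>) x' y'"
      using sector_decomposition by blast
    obtain X Y where X: "?T *v sector \<i> x y = sector \<i> X Y"
      "(cmod X)\<^sup>2 + (cmod Y)\<^sup>2 \<le> \<gamma> * F * ((cmod x)\<^sup>2 + (cmod y)\<^sup>2)" using plus by blast
    obtain X' Y' where X': "?T *v sector (-\<i>) x' y' = sector (-\<i>) X' Y'"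
      "(cmod X')\<^sup>2 + (cmod Y')\<^sup>2 \<le> \<gamma> * F * ((cmod x')\<^sup>2 + (cmod y')\<^sup>2)" using minus(1) by blast
    have Tv: "?T *v v = sector \<i> X Y + sector (-\<i>) X' Y'"
      unfolding v matrix_vector_right_distrib X(1) X'(1) ..
    show ?thesis
      unfolding Tv unfolding v norm_square_sector_sum using X(2) X'(2) by (simp add: algebra_simps)
  qed
  have "0 \<le> \<gamma> * F"
    using upper[of "axis 1 1"] by (simp add: order_trans[OF zero_le_power2])
  have "opnorm ?T \<le> sqrt (\<gamma> * F)"
    unfolding opnorm_def
  proof (rule onorm_le)
    fix v :: "complex^4"
    show "norm (?T *v v) \<le> sqrt (\<gamma> * F) * norm v"
      using real_sqrt_le_mono[OF upper[of v]] by (simp add: real_sqrt_mult)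
  qed
  then have "(opnorm ?T)\<^sup>2 \<le> \<gamma> * F"
    using pos \<open>0 \<le> \<gamma> * F\<close> by (metis power_mono real_sqrt_pow2)
  then show "N\<^sup>2 \<le> F" unfolding \<gamma>(1) pos_divide_le_eq[OF \<gamma>(2)] by (simp only: mult.commute)
  obtain x y X Y where 0: "sector (-\<i>) x y \<noteq> 0" and T: "?T *v sector (-\<i>) x y = sector (-\<i>) X Y"
    and eq: "(cmod X)\<^sup>2 + (cmod Y)\<^sup>2 = \<gamma> * (F - (cmod z)\<^sup>2) * ((cmod x)\<^sup>2 + (cmod y)\<^sup>2)"
    using minus(2) by blast
  have "\<gamma> * (F - (cmod z)\<^sup>2) * (norm (sector (-\<i>) x y))\<^sup>2 = (norm (?T *v sector (-\<i>) x y))\<^sup>2"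
    unfolding T by (simp add: norm_square_sector eq)
  also have "\<dots> \<le> (opnorm ?T * norm (sector (-\<i>) x y))\<^sup>2"
    unfolding opnorm_def by (intro power_mono onorm) simp_all
  finally have "\<gamma> * (F - (cmod z)\<^sup>2) \<le> (opnorm ?T)\<^sup>2"
    using 0 by (simp add: power_mult_distrib)
  then show "F - (cmod z)\<^sup>2 \<le> N\<^sup>2"
    unfolding \<gamma>(1) pos_le_divide_eq[OF \<gamma>(2)] by (simp only: mult.commute)
qed

text \<open>
  On either side of \<open>1\<close>, a nonnegative number is closer to \<open>1\<close> than its square is, so taking
  square roots costs nothing.
\<close>

lemma abs_sqrt_deviation:
  fixes R d e :: real
  assumes "R \<ge> 0" "1 - d \<le> R\<^sup>2" "R\<^sup>2 \<le> 1 + e" "d \<le> e"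
  shows "\<bar>R - 1\<bar> \<le> e"
proof (cases "R \<le> 1")
  case True
  then have "R\<^sup>2 \<le> R" using assms by (simp add: power2_eq_square mult_left_le)
  then show ?thesis using assms True by simp
next
  case False
  then have "R \<le> R\<^sup>2" by (simp add: power2_eq_square)
  then show ?thesis using assms False by simp
qed

text \<open>
  With \<open>R\<close> the normalised norm, the bounds above read \<open>1 - 2 \<delta> r \<le> R\<^sup>2 \<le> 1 + r\<^sup>2 + 2 \<delta> r\<close>. For the
  lower one, the deficit \<open>r\<^sup>2\<close> is absorbed by the term \<open>p r\<^sup>2\<close> of \<open>F\<close>, since \<open>p \<ge> 1\<close>.
\<close>

lemma opnorm_semigroup_asymptotic:
  fixes a b t c1 c2 :: real
  assumes a: "a > 0" and b: "b > 0" and c: "Complex c1 c2 = csqrt (A_coeff a b)"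
  shows "\<bar>sqrt ((c1\<^sup>2 + c2\<^sup>2) / (c2\<^sup>2 + 1)) * exp (t * (1 - c1) / 2)
            * opnorm (matexp ((- t) *\<^sub>R M a b)) - 1\<bar>
          \<le> exp (- 2 * c1 * t) + 8 * a / b ^ 4 * exp (- c1 * t)"
proof -
  define T where "T = opnorm (matexp ((- t) *\<^sub>R M a b))"
  have sq: "(Complex c1 c2)\<^sup>2 = A_coeff a b" by (simp add: c)
  have re: "c1\<^sup>2 - c2\<^sup>2 = 1 - b\<^sup>2 - 4 * a" and im: "c1 * c2 = - b"
    using arg_cong[OF sq, of Re] arg_cong[OF sq, of Im]
    by (simp_all add: A_coeff_def power2_eq_square)
  have c0: "Complex c1 c2 \<noteq> 0" using im b by (auto simp: complex_eq_iff)
  have den: "0 < c1\<^sup>2 + c2\<^sup>2" "0 < c2\<^sup>2 + 1"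
    using c0 by (auto simp: complex_eq_iff sum_power2_gt_zero_iff add_nonneg_pos)
  define z r where "z = exp (- t * Complex c1 c2)" and "r = exp (- c1 * t)"
  have r: "cmod z = r" "0 < r" by (simp_all add: z_def r_def mult.commute)
  define p where "p = (c2\<^sup>2 + 1) / (c1\<^sup>2 + c2\<^sup>2)"
  define F where "F = p * (cmod (1 - z))\<^sup>2 + 2 * Re z"
  define N where "N = exp (t * (1 - c1) / 2) * T"
  have p: "p = (1 + (1 + b\<^sup>2 + 4 * a) / (cmod (Complex c1 c2))\<^sup>2) / 2"
  proof -
    define D where "D = c1\<^sup>2 + c2\<^sup>2"
    have "1 + (1 + b\<^sup>2 + 4 * a) / D = (D + (1 + b\<^sup>2 + 4 * a)) / D"
      using den(1)[folded D_def] by (simp add: add_divide_distrib)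
    also have "D + (1 + b\<^sup>2 + 4 * a) = 2 * (c2\<^sup>2 + 1)" unfolding D_def using re by simp
    also have "2 * (c2\<^sup>2 + 1) / D = 2 * ((c2\<^sup>2 + 1) / D)" by (rule times_divide_eq_right[symmetric])
    finally have "(1 + (1 + b\<^sup>2 + 4 * a) / D) / 2 = 2 * ((c2\<^sup>2 + 1) / D) / 2" by (rule arg_cong)
    also have "\<dots> = (c2\<^sup>2 + 1) / D" by (rule nonzero_mult_div_cancel_left) simp
    finally have "(1 + (1 + b\<^sup>2 + 4 * a) / D) / 2 = (c2\<^sup>2 + 1) / D" .
    then show ?thesis by (simp only: p_def cmod_power2 complex.sel D_def)
  qed
  have N: "F - r\<^sup>2 \<le> N\<^sup>2" "N\<^sup>2 \<le> F"
    using opnorm_semigroup_bounds[OF a c0 sq, of t, folded p z_def, folded F_def]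
    by (simp_all add: N_def T_def r)
  \<comment> \<open>The equation for the real part of \<open>c\<^sup>2\<close>, after \<open>b\<^sup>2\<close> is replaced by \<open>c1\<^sup>2 c2\<^sup>2\<close>.\<close>
  have key: "(1 - c1\<^sup>2) * (c2\<^sup>2 + 1) = 4 * a"
  proof -
    have "c1\<^sup>2 * c2\<^sup>2 = b\<^sup>2" by (metis im power_mult_distrib power2_minus)
    then show ?thesis using re by (simp add: algebra_simps)
  qed
  have u: "0 \<le> 1 - c1\<^sup>2"
    using key a den by (metis less_eq_real_def mult_pos_pos zero_less_mult_pos2 zero_less_numeral)
  have p1: "1 \<le> p" using u den(1) by (simp add: p_def)
  define \<delta> where "\<delta> = (p - 1) / p"
  have "\<delta> = (1 - c1\<^sup>2) / (c2\<^sup>2 + 1)"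
  proof -
    have "(q / D - 1) / (q / D) = (q - D) / q" if "0 < q" "0 < D" for q D :: real
      using that by (simp add: field_simps)
    from this[OF den(2,1)] show ?thesis by (simp add: \<delta>_def p_def)
  qed
  also have "\<dots> = 4 * a / (c2\<^sup>2 + 1)\<^sup>2"
    using den by (simp add: power2_eq_square flip: key)
  also have "\<dots> \<le> 4 * a / b ^ 4"
  proof -
    have "b\<^sup>2 = c1\<^sup>2 * c2\<^sup>2" by (metis im power_mult_distrib power2_minus)
    also have "\<dots> \<le> c2\<^sup>2 + 1" using mult_right_mono[of "c1\<^sup>2" 1 "c2\<^sup>2"] u by simp
    finally have "(b\<^sup>2)\<^sup>2 \<le> (c2\<^sup>2 + 1)\<^sup>2" by (intro power_mono) auto
    then show ?thesis using a b den(2) by (intro divide_left_mono mult_pos_pos) simp_all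
  qed
  finally have \<delta>: "\<delta> \<le> 4 * a / b ^ 4" .
  have \<delta>p: "p - 1 = p * \<delta>" using p1 by (simp add: \<delta>_def)
  have Fexp: "F = p * (1 + r\<^sup>2) - 2 * (p - 1) * Re z"
    unfolding F_def r(1)[symmetric] cmod_power2 by (simp add: power2_eq_square algebra_simps)
  have Rez: "\<bar>(p - 1) * Re z\<bar> \<le> (p - 1) * r"
    using p1 abs_Re_le_cmod[of z] by (simp add: abs_mult r mult_left_mono)
  have up: "N\<^sup>2 \<le> p * (1 + (r\<^sup>2 + 2 * \<delta> * r))"
  proof -
    have "N\<^sup>2 \<le> p * (1 + r\<^sup>2) + 2 * ((p - 1) * r)" using N Rez Fexp by linarith
    also have "\<dots> = p * (1 + (r\<^sup>2 + 2 * \<delta> * r))" unfolding \<delta>p by (simp add: algebra_simps)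
    finally show ?thesis .
  qed
  have low: "p * (1 - 2 * \<delta> * r) \<le> N\<^sup>2"
  proof -
    have "p * (1 - 2 * \<delta> * r) = p - 2 * ((p - 1) * r)" unfolding \<delta>p by (simp add: algebra_simps)
    also have "\<dots> \<le> p + (p - 1) * r\<^sup>2 - 2 * ((p - 1) * Re z)"
      using Rez mult_nonneg_nonneg[of "p - 1" "r\<^sup>2"] p1 by (smt (verit) zero_le_power2)
    also have "\<dots> = F - r\<^sup>2" unfolding Fexp by (simp add: algebra_simps)
    finally show ?thesis using N by simp
  qed
  define R where "R = sqrt ((c1\<^sup>2 + c2\<^sup>2) / (c2\<^sup>2 + 1)) * N"
  have R2: "R\<^sup>2 = N\<^sup>2 / p"
    using den by (simp add: R_def p_def power_mult_distrib)
  have "0 \<le> R"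
    using den by (simp add: R_def N_def T_def opnorm_def onorm_pos_le)
  then have "\<bar>R - 1\<bar> \<le> r\<^sup>2 + 2 * \<delta> * r"
  proof (rule abs_sqrt_deviation)
    show "1 - 2 * \<delta> * r \<le> R\<^sup>2" "R\<^sup>2 \<le> 1 + (r\<^sup>2 + 2 * \<delta> * r)"
      unfolding R2 using low up p1 by (simp_all add: field_simps)
  qed simp
  also have "\<dots> \<le> r\<^sup>2 + 2 * (4 * a / b ^ 4) * r"
    using \<delta> r(2) by (intro add_left_mono mult_right_mono mult_left_mono) simp_all
  also have "\<dots> = exp (- 2 * c1 * t) + 8 * a / b ^ 4 * exp (- c1 * t)"
    by (simp add: r_def algebra_simps flip: exp_double)
  finally show ?thesis by (simp add: R_def N_def T_def mult.assoc)
qed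

theorem proposition1p6:
  shows "\<exists>C::real. C > 0 \<and> ( \<forall>a>0. \<forall>b>0. \<forall>c1 c2 :: real.
    Complex c1 c2 = csqrt (A_coeff a b) \<longrightarrow>
    (\<forall>t\<ge>0. E a b c1 t \<le> 1 / C \<longrightarrow>
      \<bar>sqrt ((c1\<^sup>2 + c2\<^sup>2) / (c2\<^sup>2 + 1)) * exp (t * (1 - c1) / 2)
          * opnorm (matexp ((- t) *\<^sub>R M a b)) - 1\<bar>
        \<le> C * E a b c1 t))"
proof (intro exI conjI allI impI)
  fix a b c1 c2 t :: real
  assume a: "a > 0" and b: "b > 0" and c: "Complex c1 c2 = csqrt (A_coeff a b)"
  \<comment> \<open>Since \<open>2 a \<le> 1 + a\<^sup>2\<close>, the constant \<open>C = 4\<close> works.\<close>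
  have "2 * a \<le> (bracket a)\<^sup>2"
    using sum_squares_bound[of 1 a] by (simp add: bracket_def)
  then have "8 * a / b ^ 4 * exp (- c1 * t) \<le> 4 * ((bracket a)\<^sup>2 / b ^ 4 * exp (- c1 * t))"
    using b by (simp add: divide_right_mono)
  moreover have "exp (- 2 * c1 * t) \<le> 4 * exp (- 2 * c1 * t)" by simp
  ultimately show "\<bar>sqrt ((c1\<^sup>2 + c2\<^sup>2) / (c2\<^sup>2 + 1)) * exp (t * (1 - c1) / 2)
          * opnorm (matexp ((- t) *\<^sub>R M a b)) - 1\<bar> \<le> 4 * E a b c1 t"
    using opnorm_semigroup_asymptotic[OF a b c, of t] unfolding E_def by argo
qed simp

end
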